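(* $\text{HG}(\mathcal{P}lanar) \geq 22$, where $\mathcal{P}lanar$ is the class of all planar graphs.
   Context: Hat guessing game $\langle G, h, g\rangle$: a sage sits at each vertex $v$ of the graph $G$; an adversary puts on the head of each sage $v$ a hat whose color is chosen from $\{0,1,\dots,h(v)-1\}$; each sage sees the hat colors of his neighbours but not his own; without communication, each sage $v$ names a list of $g(v)$ colors, determined by a deterministic strategy (fixed in advance and known to the adversary) from the colors he sees. The game is winning if there is a strategy guaranteeing that for every hat assignment at least one sage's list contains his own hat color. For a graph $G$ and integer $s\ge 1$, $\text{HG}_s(G)$ is the maximal $k$ such that the game $\langle G, h, g\rangle$ with $h$ the function constantly equal to $k$ and $g$ the function constantly equal to $s$ is winning; $\text{HG}(G)=\text{HG}_1(G)$. For a class of graphs $\mathcal{C}$, $\text{HG}_s(\mathcal{C})=\sup\{\text{HG}_s(G): G\in\mathcal{C}\}$. *)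

theory Defs
  imports "HOL-Analysis.Analysis" "HOL-Library.Extended_Nat" "Graph_Theory.Pair_Digraph"
begin

text \<open>
  Finite simple undirected graphs are the \<^locale>\<open>pair_graph\<close>s: finite, loop-free digraphs
  whose arc set is a symmetric set of pairs of vertices. An undirected edge appears as two arcs.
\<close>

section \<open>The hat guessing game\<close>

definition nbrs :: "'a pair_pre_digraph \<Rightarrow> 'a \<Rightarrow> 'a set" where
  "nbrs G v = {u. (v, u) \<in> parcs G}"

text \<open>
  \<^term>\<open>colorings W h\<close> is the set of hat assignments on the vertex set \<^term>\<open>W\<close>; they are
  extensional functions, so each assignment on \<^term>\<open>W\<close> occurs exactly once.
\<close>
definition colorings :: "'a set \<Rightarrow> ('a \<Rightarrow> nat) \<Rightarrow> ('a \<Rightarrow> nat) set" where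
  "colorings W h = (\<Pi>\<^sub>E u\<in>W. {..<h u})"

text \<open>
  The guess of the sage at \<^term>\<open>v\<close> is a function of a hat assignment on the neighbours of
  \<^term>\<open>v\<close> only.
\<close>
definition strategy ::
    "'a pair_pre_digraph \<Rightarrow> ('a \<Rightarrow> nat) \<Rightarrow> ('a \<Rightarrow> nat) \<Rightarrow> ('a \<Rightarrow> ('a \<Rightarrow> nat) \<Rightarrow> nat list) \<Rightarrow> bool" where
  "strategy G h g f \<longleftrightarrow>
     (\<forall>v\<in>pverts G. \<forall>c\<in>colorings (nbrs G v) h. length (f v c) = g v \<and> set (f v c) \<subseteq> {..<h v})"

definition winning :: "'a pair_pre_digraph \<Rightarrow> ('a \<Rightarrow> nat) \<Rightarrow> ('a \<Rightarrow> nat) \<Rightarrow> bool" where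
  "winning G h g \<longleftrightarrow>
     (\<exists>f. strategy G h g f \<and>
        (\<forall>c\<in>colorings (pverts G) h. \<exists>v\<in>pverts G. c v \<in> set (f v (restrict c (nbrs G v)))))"

text \<open>
  The supremum in \<^typ>\<open>enat\<close> is a maximum for every nonempty finite simple graph, see
  \<open>HG_is_max\<close> below; it is \<open>0\<close> for the graph without vertices.
\<close>
definition HG :: "nat \<Rightarrow> 'a pair_pre_digraph \<Rightarrow> enat" where
  "HG s G = Sup {enat k | k. winning G (\<lambda>_. k) (\<lambda>_. s)}"

definition HG_class :: "nat \<Rightarrow> 'a pair_pre_digraph set \<Rightarrow> enat" where
  "HG_class s C = (SUP G\<in>C. HG s G)"

section \<open>Planar graphs\<close>

text \<open>
  A drawing in the plane without crossings: \<^term>\<open>p\<close> places the vertices, and \<^term>\<open>\<gamma> {u, v}\<close>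
  is a simple arc representing the undirected edge \<open>{u, v}\<close> (in either orientation). An edge
  meets the vertices in its two endpoints only, and distinct edges meet in common endpoints only.
\<close>
definition plane_drawing ::
    "'a pair_pre_digraph \<Rightarrow> ('a \<Rightarrow> complex) \<Rightarrow> ('a set \<Rightarrow> real \<Rightarrow> complex) \<Rightarrow> bool" where
  "plane_drawing G p \<gamma> \<longleftrightarrow>
     inj_on p (pverts G) \<and>
     (\<forall>(u, v)\<in>parcs G.
        Path_Connected.arc (\<gamma> {u, v}) \<and>
        {pathstart (\<gamma> {u, v}), pathfinish (\<gamma> {u, v})} = {p u, p v} \<and>
        path_image (\<gamma> {u, v}) \<inter> p ` pverts G = {p u, p v}) \<and>
     (\<forall>(u, v)\<in>parcs G. \<forall>(x, y)\<in>parcs G. {u, v} \<noteq> {x, y} \<longrightarrow>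
        path_image (\<gamma> {u, v}) \<inter> path_image (\<gamma> {x, y}) \<subseteq> p ` ({u, v} \<inter> {x, y}))"

definition planar :: "'a pair_pre_digraph \<Rightarrow> bool" where
  "planar G \<longleftrightarrow> (\<exists>p \<gamma>. plane_drawing G p \<gamma>)"

text \<open>
  Vertices are natural numbers: every finite graph is isomorphic to such a graph, and \<^const>\<open>HG\<close>
  and \<^const>\<open>planar\<close> are invariant under isomorphism.
\<close>
definition Planar :: "nat pair_pre_digraph set" where
  "Planar = {G. pair_graph G \<and> planar G}"

section \<open>The maximum in the definition of the hat guessing number exists\<close>

lemma winning_const_bound:
  assumes "pair_graph G" and "winning G (\<lambda>_. k) (\<lambda>_. s)"
  shows "k \<le> s * card (pverts G)"
proof (cases "k = 0")
  case False
  interpret pair_graph G by fact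
  let ?V = "pverts G" and ?P = "\<lambda>W. colorings W (\<lambda>_. k)"
  have fin: "finite ?V" by (rule pair_finite_verts)
  have cardP: "card (?P W) = k ^ card W" and finP: "finite (?P W)" if "finite W" for W :: "'a set"
    using that by (auto simp: colorings_def card_PiE intro: finite_PiE)
  obtain f where f: "strategy G (\<lambda>_. k) (\<lambda>_. s) f"
    and win: "\<And>c. c \<in> ?P ?V \<Longrightarrow> \<exists>v\<in>?V. c v \<in> set (f v (restrict c (nbrs G v)))"
    using assms(2) unfolding winning_def by blast
  define B where "B v = {c \<in> ?P ?V. c v \<in> set (f v (restrict c (nbrs G v)))}" for v
  have B: "card (B v) \<le> s * k ^ (card ?V - 1)" if v: "v \<in> ?V" for v
  proof -
    let ?W = "?V - {v}" and ?L = "\<lambda>d. set (f v (restrict d (nbrs G v)))"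
    have N: "nbrs G v \<subseteq> ?W"
      using pair_no_loops in_arcsD2 unfolding nbrs_def by fastforce
    have L: "card (?L d) \<le> s" if "d \<in> ?P ?W" for d
    proof -
      have "restrict d (nbrs G v) \<in> ?P (nbrs G v)"
        using that N unfolding colorings_def by (auto simp: PiE_iff)
      then have "length (f v (restrict d (nbrs G v))) = s"
        using f v unfolding strategy_def by blast
      then show ?thesis using card_length by metis
    qed
    let ?F = "\<lambda>c. (restrict c ?W, c v)"
    have "inj_on ?F (B v)"
    proof (rule inj_onI)
      fix c d assume c: "c \<in> B v" and d: "d \<in> B v" and e: "?F c = ?F d"
      have "c u = d u" if "u \<in> ?V" for u
        using e that by (cases "u = v") (auto simp: restrict_def fun_eq_iff split: if_splits)
      then show "c = d" using c d unfolding B_def colorings_def by (auto intro: PiE_ext)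
    qed
    moreover have "?F ` B v \<subseteq> Sigma (?P ?W) ?L"
    proof
      fix z assume "z \<in> ?F ` B v"
      then obtain c where c: "c \<in> B v" and z: "z = ?F c" by blast
      have "restrict (restrict c ?W) (nbrs G v) = restrict c (nbrs G v)"
        using N by (metis restrict_restrict inf.absorb2)
      moreover have "restrict c ?W \<in> ?P ?W"
        using c unfolding B_def colorings_def by (auto simp: PiE_iff)
      ultimately show "z \<in> Sigma (?P ?W) ?L" using c unfolding z B_def by auto
    qed
    moreover have "finite (Sigma (?P ?W) ?L)" using finP fin by auto
    ultimately have "card (B v) \<le> card (Sigma (?P ?W) ?L)" by (rule card_inj_on_le)
    also have "\<dots> = (\<Sum>d\<in>?P ?W. card (?L d))" using finP fin by simp
    also have "\<dots> \<le> card (?P ?W) * s" using sum_bounded_above[of "?P ?W" "\<lambda>d. card (?L d)" s, OF L] by simp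
    also have "\<dots> = s * k ^ (card ?V - 1)" using cardP fin v by simp
    finally show ?thesis .
  qed
  have PB: "?P ?V \<subseteq> (\<Union>v\<in>?V. B v)" using win unfolding B_def by blast
  have "?P ?V \<noteq> {}" using False unfolding colorings_def by (auto simp: PiE_eq_empty_iff)
  with win have "?V \<noteq> {}" by blast
  with fin have n: "card ?V > 0" by (simp add: card_gt_0_iff)
  have "k ^ card ?V \<le> card (\<Union>v\<in>?V. B v)"
    using PB cardP[OF fin] card_mono[OF _ PB] finP fin by (auto simp: B_def)
  also have "\<dots> \<le> (\<Sum>v\<in>?V. card (B v))" using fin by (rule card_UN_le)
  also have "\<dots> \<le> card ?V * (s * k ^ (card ?V - 1))"
    using sum_bounded_above[of ?V "\<lambda>v. card (B v)", OF B] by simp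
  finally have le: "k ^ card ?V \<le> card ?V * (s * k ^ (card ?V - 1))" .
  from n obtain m where m: "card ?V = Suc m" using gr0_implies_Suc by blast
  have "k * k ^ m \<le> (s * card ?V) * k ^ m"
    using le unfolding m diff_Suc_1 power_Suc by (simp only: mult.assoc mult.commute mult.left_commute)
  moreover have "k ^ m > 0" using False by simp
  ultimately show ?thesis by (simp only: mult_le_cancel2)
qed simp

lemma HG_is_max:
  assumes "pair_graph G" and "pverts G \<noteq> {}" and "s \<ge> 1"
  shows "\<exists>k. HG s G = enat k \<and> winning G (\<lambda>_. k) (\<lambda>_. s) \<and>
    (\<forall>k'. winning G (\<lambda>_. k') (\<lambda>_. s) \<longrightarrow> k' \<le> k)"
proof -
  let ?K = "{k. winning G (\<lambda>_. k) (\<lambda>_. s)}"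
  have "winning G (\<lambda>_. s) (\<lambda>_. s)"
    using assms(2) unfolding winning_def strategy_def colorings_def
    by (intro exI[of _ "\<lambda>_ _. [0..<s]"]) (auto simp: PiE_iff)
  then have ne: "?K \<noteq> {}" by blast
  have fin: "finite ?K"
    using winning_const_bound[OF assms(1)] by (intro finite_subset[of ?K "{..s * card (pverts G)}"]) auto
  have max: "Max ?K \<in> ?K" "\<And>k. k \<in> ?K \<Longrightarrow> k \<le> Max ?K"
    using Max_in[OF fin ne] Max_ge[OF fin] by auto
  have "HG s G = enat (Max ?K)"
    unfolding HG_def using max by (intro antisym Sup_least Sup_upper) auto
  with max show ?thesis by blast
qed

end

theory Submission
  imports Defs "HOL-Number_Theory.Cong"
begin

text \<open>
  If many disjoint copies of a graph are joined to a new vertex, then a win on the copies with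
  \<open>s (s + 1)\<close> guesses yields a win on the whole graph with \<open>s\<close> guesses and the same number of
  colours. Paths are won with 6 guesses and 22 colours; joining paths to a hub leaves 2 guesses, and
  joining the resulting outerplanar graphs to one further vertex leaves 1 guess in a planar graph.
\<close>

section \<open>Strategies\<close>

definition graph_on :: "'a rel \<Rightarrow> 'a set \<Rightarrow> 'a pair_pre_digraph" where
  "graph_on E V = \<lparr>pverts = V, parcs = Restr E V\<rparr>"

lemma pverts_graph_on [simp]: "pverts (graph_on E V) = V"
  by (simp add: graph_on_def)

lemma nbrs_graph_on: "nbrs (graph_on E V) v = {u \<in> V. v \<in> V \<and> (v, u) \<in> E}"
  by (auto simp: graph_on_def nbrs_def)

text \<open>Strategies may thus be given by sets: each is listed and padded with colour 0, which is
  legal since \<open>0 < k\<close>.\<close>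

lemma winning_setI:
  assumes "0 < k"
    and S: "\<And>v c. v \<in> pverts G \<Longrightarrow> c \<in> colorings (nbrs G v) (\<lambda>_. k) \<Longrightarrow> S v c \<subseteq> {..<k} \<and> card (S v c) \<le> s"
    and win: "\<And>c. c \<in> colorings (pverts G) (\<lambda>_. k) \<Longrightarrow> \<exists>v\<in>pverts G. c v \<in> S v (restrict c (nbrs G v))"
    and nb: "\<And>v. nbrs G v \<subseteq> pverts G"
  shows "winning G (\<lambda>_. k) (\<lambda>_. s)"
proof -
  define f where "f v c = sorted_list_of_set (S v c) @ replicate (s - card (S v c)) 0" for v c
  have fin: "finite (S v c)" if "v \<in> pverts G" "c \<in> colorings (nbrs G v) (\<lambda>_. k)" for v c
    using S[OF that] finite_subset by blast
  have "strategy G (\<lambda>_. k) (\<lambda>_. s) f"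
    unfolding strategy_def f_def using S fin \<open>0 < k\<close> by auto
  moreover have "\<exists>v\<in>pverts G. c v \<in> set (f v (restrict c (nbrs G v)))"
    if c: "c \<in> colorings (pverts G) (\<lambda>_. k)" for c
  proof -
    obtain v where v: "v \<in> pverts G" "c v \<in> S v (restrict c (nbrs G v))"
      using win[OF c] by blast
    have "restrict c (nbrs G v) \<in> colorings (nbrs G v) (\<lambda>_. k)"
      using c nb unfolding colorings_def by (auto simp: PiE_iff)
    from fin[OF v(1) this] v show ?thesis
      unfolding f_def by (intro bexI[of _ v]) auto
  qed
  ultimately show ?thesis unfolding winning_def by blast
qed

text \<open>
  The guesses of a copy \<open>W T\<close> are split into \<open>s + 1\<close> lists of length \<open>s\<close>, one for each colour in
  \<open>T\<close>, and the colour of the apex \<open>a\<close> selects the list that is used. No assignment of hats makes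
  the whole copy wrong for every apex colour in \<open>T\<close>, so at most \<open>s\<close> apex colours remain.
\<close>
lemma winning_cone:
  fixes E :: "'a rel"
  assumes k: "0 < k" and a: "a \<in> V" and "sym E"
    and WV: "\<And>T. T \<subseteq> {..<k} \<Longrightarrow> card T = Suc s \<Longrightarrow> W T \<subseteq> V \<inter> E `` {a} - {a}"
    and disj: "\<And>T T'. T \<subseteq> {..<k} \<Longrightarrow> card T = Suc s \<Longrightarrow> T' \<subseteq> {..<k} \<Longrightarrow> card T' = Suc s \<Longrightarrow>
      T \<noteq> T' \<Longrightarrow> W T \<inter> W T' = {}"
    and win: "\<And>T. T \<subseteq> {..<k} \<Longrightarrow> card T = Suc s \<Longrightarrow>
      winning (graph_on E (W T)) (\<lambda>_. k) (\<lambda>_. s * Suc s)"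
  shows "winning (graph_on E V) (\<lambda>_. k) (\<lambda>_. s)"
proof -
  define TT where "TT = {T. T \<subseteq> {..<k} \<and> card T = Suc s}"
  let ?N = "\<lambda>T. nbrs (graph_on E (W T))"
  have "\<forall>T\<in>TT. \<exists>f. strategy (graph_on E (W T)) (\<lambda>_. k) (\<lambda>_. s * Suc s) f \<and>
      (\<forall>c\<in>colorings (W T) (\<lambda>_. k). \<exists>v\<in>W T. c v \<in> set (f v (restrict c (?N T v))))"
    using win unfolding winning_def TT_def by auto
  then obtain F where F: "\<And>T. T \<in> TT \<Longrightarrow> strategy (graph_on E (W T)) (\<lambda>_. k) (\<lambda>_. s * Suc s) (F T)"
    and Fwin: "\<And>T c. T \<in> TT \<Longrightarrow> c \<in> colorings (W T) (\<lambda>_. k) \<Longrightarrow>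
      \<exists>v\<in>W T. c v \<in> set (F T v (restrict c (?N T v)))"
    by (metis (no_types, lifting))
  have "\<forall>T\<in>TT. \<exists>e. bij_betw e T {..<Suc s}"
  proof
    fix T assume "T \<in> TT"
    then have "finite T" "card T = card {..<Suc s}"
      using finite_subset by (auto simp: TT_def)
    then show "\<exists>e. bij_betw e T {..<Suc s}" using finite_same_card_bij by blast
  qed
  then obtain e where e: "\<And>T. T \<in> TT \<Longrightarrow> bij_betw (e T) T {..<Suc s}" by metis
  define g where "g T v b c = set (take s (drop (e T b * s) (F T v (restrict c (?N T v)))))" for T v b c
  \<comment> \<open>The apex guesses the colours under which no sage in any copy is right; for every
    other apex colour some copy contains a correct guess.\<close>
  define X where "X c = {b. b < k \<and> (\<forall>T\<in>TT. \<forall>v\<in>W T. c v \<notin> g T v b c)}" for c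
  define Tof where "Tof v = (SOME T. T \<in> TT \<and> v \<in> W T)" for v
  define S where "S v c = (if v = a then X c else
      if (\<exists>T\<in>TT. v \<in> W T) \<and> c a \<in> {..<k} then g (Tof v) v (c a) c else {})" for v c
  have Tof: "Tof v = T" if "T \<in> TT" "v \<in> W T" for v T
    unfolding Tof_def
  proof (rule some_equality)
    show "T' = T" if "T' \<in> TT \<and> v \<in> W T'" for T'
      using disj that \<open>T \<in> TT\<close> \<open>v \<in> W T\<close> unfolding TT_def by blast
  qed (use that in simp)
  have NW: "?N T v \<subseteq> W T" for T v by (auto simp: nbrs_graph_on)
  have Fcol: "length (F T v (restrict c (?N T v))) = s * Suc s"
      "set (F T v (restrict c (?N T v))) \<subseteq> {..<k}"
    if "T \<in> TT" "v \<in> W T" "\<And>u. u \<in> ?N T v \<Longrightarrow> c u < k" for T v c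
  proof -
    have "restrict c (?N T v) \<in> colorings (?N T v) (\<lambda>_. k)"
      using that(3) unfolding colorings_def by (auto simp: PiE_iff)
    then show "length (F T v (restrict c (?N T v))) = s * Suc s"
      "set (F T v (restrict c (?N T v))) \<subseteq> {..<k}"
      using F[OF that(1)] that(2) unfolding strategy_def by auto
  qed
  have cardX: "card (X c) \<le> s" if c: "\<And>T u. T \<in> TT \<Longrightarrow> u \<in> W T \<Longrightarrow> c u < k" for c
  proof (rule ccontr)
    assume "\<not> card (X c) \<le> s"
    then have "Suc s \<le> card (X c)" by simp
    \<comment> \<open>These \<open>s + 1\<close> colours index a copy. A correct guess in the full
      list of that copy has some position \<open>q\<close>, hence lies in block
      \<open>q div s\<close>; this block is used for a colour \<open>b\<close> in \<open>T\<close>,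
      which then cannot belong to \<open>X c\<close>.\<close>
    then obtain T where T: "T \<subseteq> X c" "card T = Suc s"
      using obtain_subset_with_card_n by metis
    then have TT: "T \<in> TT" unfolding TT_def X_def by auto
    let ?d = "restrict c (W T)"
    have "?d \<in> colorings (W T) (\<lambda>_. k)"
      using c[OF TT] unfolding colorings_def by (auto simp: PiE_iff)
    from Fwin[OF TT this] obtain v where v: "v \<in> W T"
      and "?d v \<in> set (F T v (restrict ?d (?N T v)))" by blast
    moreover have "restrict ?d (?N T v) = restrict c (?N T v)"
      using NW by (metis restrict_restrict inf.absorb2)
    ultimately have "c v \<in> set (F T v (restrict c (?N T v)))" by simp
    then obtain q where q: "q < length (F T v (restrict c (?N T v)))"
      and cq: "F T v (restrict c (?N T v)) ! q = c v" by (metis in_set_conv_nth)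
    have len: "length (F T v (restrict c (?N T v))) = s * Suc s"
      using Fcol(1)[OF TT v] c[OF TT] NW by blast
    have s: "s > 0" using q len by (cases s) auto
    have "q div s \<in> {..<Suc s}"
      using q len s by (simp add: less_mult_imp_div_less mult.commute)
    then obtain b where b: "b \<in> T" "e T b = q div s"
      using e[OF TT] by (metis bij_betw_iff_bijections)
    let ?L = "take s (drop (e T b * s) (F T v (restrict c (?N T v))))"
    have eq: "e T b * s + q mod s = q" using b by simp
    have "q mod s < length ?L"
      using q s eq by (simp add: less_diff_conv add.commute)
    moreover have "e T b * s \<le> length (F T v (restrict c (?N T v)))"
      using q eq by linarith
    then have "?L ! (q mod s) = c v" using s cq by (simp add: eq)
    ultimately have "c v \<in> g T v b c" unfolding g_def by (metis nth_mem)
    then show False using b T TT v unfolding X_def by blast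
  qed
  have nbV: "?N T v \<subseteq> nbrs (graph_on E V) v" "a \<in> nbrs (graph_on E V) v" "v \<in> nbrs (graph_on E V) a"
    "v \<noteq> a" "W T \<subseteq> nbrs (graph_on E V) a"
    if "T \<in> TT" "v \<in> W T" for T v
    using WV[of T] that a \<open>sym E\<close> unfolding TT_def by (auto simp: nbrs_graph_on dest: symD)
  show ?thesis
  proof (rule winning_setI[OF k, where S = S])
    fix v c assume v: "v \<in> pverts (graph_on E V)"
      and c: "c \<in> colorings (nbrs (graph_on E V) v) (\<lambda>_. k)"
    have ck: "c u < k" if "u \<in> nbrs (graph_on E V) v" for u
      using c that unfolding colorings_def by auto
    show "S v c \<subseteq> {..<k} \<and> card (S v c) \<le> s"
    proof (cases "v = a")
      case True
      have "card (X c) \<le> s" using ck nbV True by (intro cardX) blast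
      then show ?thesis using True unfolding S_def X_def by auto
    next
      case False
      show ?thesis
      proof (cases "(\<exists>T\<in>TT. v \<in> W T) \<and> c a \<in> {..<k}")
        case True
        then obtain T where T: "T \<in> TT" "v \<in> W T" by blast
        have sub: "set (F T v (restrict c (?N T v))) \<subseteq> {..<k}"
          using Fcol(2)[OF T] ck nbV(1)[OF T] by blast
        have "S v c = g T v (c a) c" using False True Tof[OF T] unfolding S_def by simp
        moreover have "g T v (c a) c \<subseteq> set (F T v (restrict c (?N T v)))"
          unfolding g_def using set_take_subset set_drop_subset by fast
        moreover have "card (g T v (c a) c) \<le> s"
          unfolding g_def by (rule order.trans[OF card_length]) simp
        ultimately show ?thesis using sub by auto
      qed (auto simp: S_def False)
    qed
  next
    fix c assume c: "c \<in> colorings (pverts (graph_on E V)) (\<lambda>_. k)"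
    then have ck: "c u < k" if "u \<in> V" for u using that unfolding colorings_def by auto
    let ?r = "\<lambda>v. restrict c (nbrs (graph_on E V) v)"
    have rr: "restrict (?r u) (?N T v) = restrict c (?N T v)"
      if "?N T v \<subseteq> nbrs (graph_on E V) u" for T u v
      using that by (simp add: Int_absorb1)
    show "\<exists>v\<in>pverts (graph_on E V). c v \<in> S v (?r v)"
    proof (cases "c a \<in> X c")
      case True
      \<comment> \<open>The apex sees all copies completely, so \<open>X\<close> can be computed
        from its view.\<close>
      have "c v \<notin> g T v b c \<longleftrightarrow> ?r a v \<notin> g T v b (?r a)" if "T \<in> TT" "v \<in> W T" for T v b
      proof -
        have "?N T v \<subseteq> nbrs (graph_on E V) a" using NW nbV(5)[OF that] by blast
        then show ?thesis using nbV(3)[OF that] rr unfolding g_def by simp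
      qed
      then have "X (?r a) = X c" unfolding X_def by auto
      then show ?thesis using True a unfolding S_def by (intro bexI[of _ a]) auto
    next
      case False
      then obtain T v where T: "T \<in> TT" "v \<in> W T" and v: "c v \<in> g T v (c a) c"
        using ck[OF a] unfolding X_def by auto
      have vV: "v \<in> V" using WV[of T] T unfolding TT_def by auto
      have "S v (?r v) = g T v (c a) c"
        using nbV[OF T] T Tof[OF T] ck[OF a] rr[OF nbV(1)[OF T]] unfolding S_def g_def by auto
      with v vV show ?thesis by auto
    qed
  qed (auto simp: nbrs_graph_on)
qed

section \<open>Paths\<close>

definition cyc :: "nat \<Rightarrow> nat \<Rightarrow> nat \<Rightarrow> nat set" where
  "cyc k m y = (\<lambda>j. (y * m + j) mod k) ` {..<m}"

text \<open>Every colour is reached from \<open>z * m\<close> by a shift \<open>r < k\<close>, and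
  shifts below \<open>m\<close> stay inside the arc; so the complement is again an arc, beginning
  where the first one ends.\<close>

lemma not_in_cyc:
  assumes "y < k" "y \<notin> cyc k m z" "m \<le> k"
  shows "\<exists>t<k - m. y = (z * m + m + t) mod k"
proof -
  \<comment> \<open>The summand \<open>k * (z * m)\<close> vanishes modulo \<open>k\<close> and
    keeps the subtraction from truncating.\<close>
  define r where "r = (y + k * (z * m) - z * m) mod k"
  have k: "k > 0" using assms by simp
  have zk: "z * m \<le> k * (z * m)" using k by simp
  have r: "r < k" using k unfolding r_def by simp
  have "(z * m + r) mod k = (z * m + (y + k * (z * m) - z * m)) mod k"
    unfolding r_def by (simp add: mod_add_right_eq)
  also have "z * m + (y + k * (z * m) - z * m) = y + k * (z * m)"
    using zk by linarith
  also have "\<dots> mod k = y" using assms(1) by simp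
  finally have yr: "y = (z * m + r) mod k" by simp
  then have "m \<le> r" using assms(2) unfolding cyc_def by (metis image_eqI lessThan_iff not_le)
  then show ?thesis using r yr assms(3) by (intro exI[of _ "r - m"]) auto
qed

text \<open>
  Going through consecutive \<open>y\<close>, the intervals \<open>cyc k m y\<close> are laid end to end around the circle,
  so \<open>k - m'\<close> of them wind around it at most \<open>s\<close> times.
\<close>
lemma card_cyc_le:
  assumes k: "0 < k" and m': "m' \<le> k" and le: "(k - m') * m \<le> k * s"
  shows "card {y. y < k \<and> y \<notin> cyc k m' z \<and> x \<in> cyc k m y} \<le> s"
proof -
  define Y where "Y = {y. y < k \<and> y \<notin> cyc k m' z \<and> x \<in> cyc k m y}"
  define b where "b = z * m' + m'"
  \<comment> \<open>The \<open>y\<close> outside the arc at \<open>z\<close> are consecutive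
    residues \<open>b + t\<close>. Unrolling their arcs onto a line that starts at
    \<open>b * m\<close> puts \<open>x\<close> at offset \<open>t * m + j\<close>, below
    \<open>(k - m') * m\<close>.\<close>
  have "\<exists>t j. t < k - m' \<and> j < m \<and> y = (b + t) mod k \<and> x = (b * m + (t * m + j)) mod k"
    if y: "y \<in> Y" for y
  proof -
    obtain t where t: "t < k - m'" "y = (b + t) mod k"
      using y[unfolded Y_def] not_in_cyc[of y k m' z] m' unfolding b_def by auto
    obtain j where j: "j < m" "x = (y * m + j) mod k" using y unfolding Y_def cyc_def by auto
    have "x = ((b + t) * m + j) mod k"
      unfolding j(2) t(2) by (metis mod_add_left_eq mod_mult_left_eq)
    then show ?thesis using t j by (intro exI[of _ t] exI[of _ j]) (simp add: algebra_simps)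
  qed
  then obtain t j where tj: "\<And>y. y \<in> Y \<Longrightarrow> t y < k - m'" "\<And>y. y \<in> Y \<Longrightarrow> j y < m"
    "\<And>y. y \<in> Y \<Longrightarrow> y = (b + t y) mod k" "\<And>y. y \<in> Y \<Longrightarrow> x = (b * m + (t y * m + j y)) mod k"
    by metis
  let ?u = "\<lambda>y. (t y * m + j y)"
  \<comment> \<open>These offsets are congruent modulo \<open>k\<close>, so the number of full
    turns, which is less than \<open>s\<close>, determines the offset and with it
    \<open>y\<close>.\<close>
  have "inj_on (\<lambda>y. ?u y div k) Y"
  proof (rule inj_onI)
    fix y y' assume y: "y \<in> Y" "y' \<in> Y" and eq: "?u y div k = ?u y' div k"
    have "(b * m + ?u y) mod k = (b * m + ?u y') mod k"
      using tj(4)[OF y(1)] tj(4)[OF y(2)] by (rule trans[OF sym])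
    then have "?u y mod k = ?u y' mod k"
      using cong_add_lcancel_nat[unfolded cong_def] by blast
    with eq have "?u y = ?u y'" by (metis div_mult_mod_eq)
    moreover have "t w = ?u w div m" if "w \<in> Y" for w using tj(2)[OF that] by simp
    ultimately have "t y = t y'" using y by metis
    then show "y = y'" using tj(3) y by metis
  qed
  moreover have "?u y div k < s" if y: "y \<in> Y" for y
  proof -
    have "?u y < Suc (t y) * m" using tj(2)[OF y] by simp
    also have "\<dots> \<le> (k - m') * m" using tj(1)[OF y] by (intro mult_right_mono) auto
    finally show ?thesis using le by (intro less_mult_imp_div_less) (simp add: mult.commute)
  qed
  ultimately show ?thesis
    using card_inj_on_le[of "\<lambda>y. ?u y div k" Y "{..<s}"] unfolding Y_def[symmetric] by auto
qed

text \<open>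
  Unless somebody guesses correctly, the hat \<open>x\<close> of the \<open>i\<close>-th sage (\<open>i = 1, \<dots>, n\<close>) and the hat \<open>y\<close> of the
  next one satisfy \<open>x \<in> cyc k (m i) y\<close>, which leaves no possibility at the end, where \<open>m n = 0\<close>.
\<close>
lemma winning_path:
  fixes E :: "nat rel"
  assumes k: "0 < k" and "sym E" and path: "\<And>i. Suc i < n \<Longrightarrow> (a + i, a + Suc i) \<in> E"
    and m: "m 0 = k" "m n = 0" "\<And>i. i \<le> n \<Longrightarrow> m i \<le> k"
    and step: "\<And>i. i < n \<Longrightarrow> (k - m (Suc i)) * m i \<le> k * s"
  shows "winning (graph_on E {a..<a + n}) (\<lambda>_. k) (\<lambda>_. s)"
proof -
  \<comment> \<open>The first sage has no predecessor; the default 0 lies in every arc of length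
    \<open>m 0 = k\<close>.\<close>
  define x where "x v c = (if v = a then 0 else c (v - 1))" for v and c :: "nat \<Rightarrow> nat"
  \<comment> \<open>For the last sage \<open>c (Suc v)\<close> is an arbitrary value; since
    \<open>m n = 0\<close>, its arc is empty anyway.\<close>
  define S where "S v c =
    {y. y < k \<and> y \<notin> cyc k (m (Suc (v - a))) (c (Suc v)) \<and> x v c \<in> cyc k (m (v - a)) y}" for v c
  show ?thesis
  proof (rule winning_setI[OF k, where S = S])
    fix v c assume "v \<in> pverts (graph_on E {a..<a + n})"
    then have "card (S v c) \<le> s"
      unfolding S_def using m(3) step by (intro card_cyc_le[OF k]) auto
    then show "S v c \<subseteq> {..<k} \<and> card (S v c) \<le> s" unfolding S_def by auto
  next
    fix c assume "c \<in> colorings (pverts (graph_on E {a..<a + n})) (\<lambda>_. k)"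
    then have c: "c v < k" if "v \<in> {a..<a + n}" for v
      using that unfolding colorings_def by auto
    let ?N = "nbrs (graph_on E {a..<a + n})"
    have n: "n > 0" using m(1,2) k by (cases n) auto
    have full: "b \<in> cyc k k y" if "b < k" for b y
      using that unfolding cyc_def by auto
    show "\<exists>v\<in>pverts (graph_on E {a..<a + n}). c v \<in> S v (restrict c (?N v))"
    proof (rule ccontr)
      assume "\<not> ?thesis"
      then have wrong: "c (a + i) \<notin> S (a + i) (restrict c (?N (a + i)))" if "i < n" for i
        using that by auto
      have "c (a + i) \<in> cyc k (m (Suc i)) (restrict c (?N (a + i)) (Suc (a + i)))" if "i < n" for i
        using that
      proof (induction i)
        case 0
        then show ?case using wrong[of 0] full[of 0] k m(1) c[of a] unfolding S_def x_def by auto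
      next
        case (Suc i)
        have "(a + i, Suc (a + i)) \<in> E" using path[of i] Suc.prems by simp
        moreover from this have "(Suc (a + i), a + i) \<in> E" using \<open>sym E\<close> by (auto dest: symD)
        ultimately have N: "Suc (a + i) \<in> ?N (a + i)" "a + i \<in> ?N (Suc (a + i))"
          using Suc.prems by (auto simp: nbrs_graph_on)
        have "c (a + i) \<in> cyc k (m (Suc i)) (c (Suc (a + i)))"
          using Suc.IH Suc.prems N by simp
        then show ?case using wrong[OF Suc.prems] N c[of "Suc (a + i)"] Suc.prems
          unfolding S_def x_def by auto
      qed
      from this[of "n - 1"] n m(2) show False unfolding cyc_def by simp
    qed
  qed (auto simp: nbrs_graph_on)
qed


section \<open>Fans over paths are planar\<close>

text \<open>
  The apex \<open>0\<close> is joined to all vertices and each hub in \<open>H\<close> to the vertices between it and the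
  next hub; these vertices form a path.
\<close>
definition fan_edge :: "nat set \<Rightarrow> nat \<Rightarrow> nat \<Rightarrow> bool" where
  "fan_edge H u v \<longleftrightarrow> u < v \<and> (u = 0 \<or> {u<..v} \<inter> H = {} \<and> (u \<in> H \<or> v = Suc u))"

definition fan_rel :: "nat set \<Rightarrow> nat rel" where
  "fan_rel H = {(u, v). fan_edge H u v \<or> fan_edge H v u}"

text \<open>
  The vertex \<open>v > 0\<close> lies on the ray \<open>Re z = v * Im z\<close> from the apex, so that edges are separated by
  the slopes \<open>Re z / Im z\<close> and by the heights \<open>Im z\<close>.
\<close>
definition pos :: "nat set \<Rightarrow> nat \<Rightarrow> complex" where
  "pos H v = (if v = 0 then 0 else if v \<in> H then Complex (2 * v) 2 else Complex v 1)"

lemma inj_pos: "inj (pos H)"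
  by (rule injI) (auto simp: pos_def complex_eq_iff split: if_splits)

lemma fan_edge_no_hub: "fan_edge H u v \<Longrightarrow> 0 < u \<Longrightarrow> u < w \<Longrightarrow> w \<le> v \<Longrightarrow> w \<notin> H"
  unfolding fan_edge_def by auto

section \<open>Slopes and heights of points on edges\<close>

lemma segment_apex:
  assumes "z \<in> closed_segment (pos H 0) (pos H v)"
  shows "Re z = v * Im z \<and> 0 \<le> Im z \<and> (v \<notin> H \<longrightarrow> Im z \<le> 1)"
  using assms by (auto simp: pos_def in_segment)

lemma segment_hub:
  assumes "z \<in> closed_segment (pos H u) (pos H v)" "0 < u" "u \<in> H" "fan_edge H u v"
  shows "1 \<le> Im z \<and> Im z \<le> 2 \<and> Re z = 2 * u * (Im z - 1) + v * (2 - Im z)"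
proof -
  have v: "v \<notin> H" "0 < v"
    using assms(4) fan_edge_no_hub[OF assms(4,2), of v] unfolding fan_edge_def by auto
  obtain t where t: "0 \<le> t" "t \<le> 1" and z: "z = (1 - t) *\<^sub>R pos H u + t *\<^sub>R pos H v"
    using assms(1) unfolding in_segment by blast
  have Re: "Re z = (1 - t) * (2 * u) + t * v" and Im: "Im z = 2 - t"
    using v assms(2,3) by (simp_all add: z pos_def)
  then show ?thesis using t unfolding Re Im by (simp add: algebra_simps)
qed

lemma segment_path:
  assumes "z \<in> closed_segment (pos H u) (pos H v)" "0 < u" "u \<notin> H" "fan_edge H u v"
  shows "v = Suc u \<and> v \<notin> H \<and> Im z = 1 \<and> real u \<le> Re z \<and> Re z \<le> real v"
proof -
  have v: "v \<notin> H" "0 < v"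
    using assms(4) fan_edge_no_hub[OF assms(4,2), of v] unfolding fan_edge_def by auto
  obtain t where t: "0 \<le> t" "t \<le> 1" and z: "z = (1 - t) *\<^sub>R pos H u + t *\<^sub>R pos H v"
    using assms(1) unfolding in_segment by blast
  have "Re z = (1 - t) * u + t * v" "Im z = 1"
    using v assms(2,3) by (simp_all add: z pos_def)
  moreover have "v = Suc u" using assms(2-4) unfolding fan_edge_def by simp
  ultimately show ?thesis using t v by (simp add: algebra_simps)
qed

lemma pos_eqI:
  assumes "0 < v" "Re z = real v * Im z" "Im z = (if v \<in> H then 2 else 1)"
  shows "z = pos H v"
  using assms by (auto simp: pos_def complex_eq_iff)

text \<open>Both gaps factor: \<open>Re z - u * Im z\<close> is \<open>(v - u) * (2 - Im z)\<close>,
  and \<open>v * Im z - Re z\<close> is \<open>2 * (v - u) * (Im z - 1)\<close>. So the edge runs in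
  the sector between the rays of \<open>u\<close> and \<open>v\<close> and touches these rays only
  at its endpoints.\<close>

lemma segment_hub_slope:
  assumes "z \<in> closed_segment (pos H u) (pos H v)" "0 < u" "u \<in> H" "fan_edge H u v"
  shows "u * Im z \<le> Re z" "Re z \<le> v * Im z"
    "Re z = u * Im z \<Longrightarrow> z = pos H u" "Im z = 1 \<Longrightarrow> z = pos H v"
proof -
  note z = segment_hub[OF assms]
  have uv: "u < v" "v \<notin> H"
    using assms(4) fan_edge_no_hub[OF assms(4,2), of v] unfolding fan_edge_def by auto
  have eq1: "Re z - u * Im z = (real v - real u) * (2 - Im z)"
    using z by (simp add: algebra_simps)
  have eq2: "v * Im z - Re z = 2 * (real v - real u) * (Im z - 1)"
    using z by (simp add: algebra_simps)
  have "0 \<le> (real v - real u) * (2 - Im z)" "0 \<le> 2 * (real v - real u) * (Im z - 1)"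
    using z uv by simp_all
  then show "u * Im z \<le> Re z" "Re z \<le> v * Im z" unfolding eq1[symmetric] eq2[symmetric] by simp_all
  show "z = pos H u" if "Re z = u * Im z"
    using that eq1 uv assms by (intro pos_eqI) auto
  show "z = pos H v" if "Im z = 1"
    using that z uv by (intro pos_eqI) auto
qed

section \<open>Edges meet only in common endpoints\<close>

lemma fan_crossing_apex:
  assumes z: "z \<in> closed_segment (pos H 0) (pos H w)" "z \<in> closed_segment (pos H u) (pos H v)"
    and "0 < w" "0 < u" "fan_edge H u v"
  shows "w \<in> {u, v} \<and> z = pos H w"
proof (cases "u \<in> H")
  case True
  note hub = segment_hub[OF z(2) \<open>0 < u\<close> True \<open>fan_edge H u v\<close>]
    and slope = segment_hub_slope[OF z(2) \<open>0 < u\<close> True \<open>fan_edge H u v\<close>]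
  have a: "Re z = w * Im z" "w \<notin> H \<longrightarrow> Im z \<le> 1" using segment_apex[OF z(1)] by auto
  have Im: "0 < Im z" using hub by linarith
  \<comment> \<open>The hub edge stays in the sector between the rays of its endpoints, so the ray
    of \<open>w\<close> lies there.\<close>
  have "u \<le> w" "w \<le> v" using slope(1,2) a(1) Im by simp_all
  show ?thesis
  proof (cases "w = u")
    case True
    then show ?thesis using a slope(3) by simp
  next
    case False
    with \<open>u \<le> w\<close> \<open>w \<le> v\<close> have "w \<notin> H" using fan_edge_no_hub[OF assms(5,4)] by simp
    \<comment> \<open>As \<open>w\<close> is not a hub, its apex edge stops at height 1, which the
      hub edge reaches only at \<open>v\<close>.\<close>
    with a(2) hub have "Im z = 1" by linarith
    with slope(4) have "z = pos H v" by simp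
    moreover have "w = v" using a(1) \<open>Im z = 1\<close> hub by simp
    ultimately show ?thesis by simp
  qed
next
  case False
  note path = segment_path[OF z(2) \<open>0 < u\<close> False \<open>fan_edge H u v\<close>]
  have a: "Re z = w * Im z" using segment_apex[OF z(1)] by auto
  have "w \<in> {u, v}" using path a by auto
  then show ?thesis using path a False \<open>0 < w\<close> by (auto intro: pos_eqI)
qed

text \<open>At a given height, two edges from one hub differ horizontally by
  \<open>(v - v') * (2 - Im z)\<close>, so they meet only at the hub. For different hubs
  \<open>v < u'\<close>, which separates the sectors. A path edge has height 1, where the hub edge
  is at \<open>v\<close>. The last assumption orders the hubs, by symmetry.\<close>

lemma fan_crossing_hub:
  assumes z: "z \<in> closed_segment (pos H u) (pos H v)" "z \<in> closed_segment (pos H u') (pos H v')"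
    and "0 < u" "0 < u'" "fan_edge H u v" "fan_edge H u' v'" "u \<in> H" "(u, v) \<noteq> (u', v')"
    and "u' \<in> H \<longrightarrow> u \<le> u'"
  shows "z \<in> pos H ` ({u, v} \<inter> {u', v'})"
proof -
  note hub = segment_hub[OF z(1) \<open>0 < u\<close> \<open>u \<in> H\<close> \<open>fan_edge H u v\<close>]
    and slope = segment_hub_slope[OF z(1) \<open>0 < u\<close> \<open>u \<in> H\<close> \<open>fan_edge H u v\<close>]
  show ?thesis
  proof (cases "u' \<in> H")
    case True
    note hub' = segment_hub[OF z(2) \<open>0 < u'\<close> True \<open>fan_edge H u' v'\<close>]
      and slope' = segment_hub_slope[OF z(2) \<open>0 < u'\<close> True \<open>fan_edge H u' v'\<close>]
    show ?thesis
    proof (cases "u = u'")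
      case True
      have "(real v - real v') * (2 - Im z) = 0"
        using hub hub' True by (simp add: algebra_simps)
      then have "Im z = 2" using True \<open>(u, v) \<noteq> (u', v')\<close> by simp
      then have "z = pos H u" using slope(3) hub by simp
      then show ?thesis using True by simp
    next
      case False
      have "u < u'" using False True assms(9) by simp
      then have "v < u'"
        using True fan_edge_no_hub[OF assms(5) \<open>0 < u\<close>, of u'] by (meson not_le)
      then have "v * Im z < u' * Im z" using hub by simp
      then show ?thesis using slope(2) slope'(1) by linarith
    qed
  next
    case False
    note path' = segment_path[OF z(2) \<open>0 < u'\<close> False \<open>fan_edge H u' v'\<close>]
    then have "v \<in> {u', v'}" using hub by auto
    moreover have "z = pos H v" using slope(4) path' by simp
    ultimately show ?thesis by blast
  qed
qed

text \<open>Distinct apex edges lie on different rays, and distinct path edges are different unit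
  intervals with integer ends at height 1; up to symmetry the other cases are those treated
  above.\<close>

lemma fan_crossing:
  assumes z: "z \<in> closed_segment (pos H u) (pos H v)" "z \<in> closed_segment (pos H u') (pos H v')"
    and e: "fan_edge H u v" "fan_edge H u' v'" and ne: "(u, v) \<noteq> (u', v')"
  shows "z \<in> pos H ` ({u, v} \<inter> {u', v'})"
proof -
  have v: "0 < v" "0 < v'" using e unfolding fan_edge_def by auto
  consider "u = 0" "u' = 0" | "u = 0" "0 < u'" | "0 < u" "u' = 0"
    | "0 < u" "0 < u'" "u \<in> H" "u' \<in> H \<longrightarrow> u \<le> u'"
    | "0 < u" "0 < u'" "u' \<in> H" "u \<in> H \<longrightarrow> u' \<le> u"
    | "0 < u" "0 < u'" "u \<notin> H" "u' \<notin> H"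
    by force
  then show ?thesis
  proof cases
    case 1
    then have "real v * Im z = real v' * Im z" "v \<noteq> v'" "Re z = v * Im z"
      using z ne segment_apex[of z H v] segment_apex[of z H v'] by auto
    then have "z = pos H 0" by (simp add: pos_def complex_eq_iff)
    then show ?thesis using 1 by simp
  next
    case 2
    then show ?thesis using fan_crossing_apex[of z H v u' v'] z v e by auto
  next
    case 3
    then show ?thesis using fan_crossing_apex[of z H v' u v] z v e by auto
  next
    case 4
    then show ?thesis using fan_crossing_hub z e ne by simp
  next
    case 5
    then have "z \<in> pos H ` ({u', v'} \<inter> {u, v})" using z e ne by (intro fan_crossing_hub) auto
    then show ?thesis by (simp add: Int_commute)
  next
    case 6
    note path = segment_path[OF z(1) 6(1,3) e(1)] segment_path[OF z(2) 6(2,4) e(2)]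
    have "u \<noteq> u'" using ne path by auto
    have "v = u' \<or> v' = u" using path \<open>u \<noteq> u'\<close> by linarith
    then show ?thesis
    proof
      assume "v = u'"
      then have "z = pos H v" using path v by (intro pos_eqI) auto
      then show ?thesis using \<open>v = u'\<close> by simp
    next
      assume "v' = u"
      then have "z = pos H v'" using path v by (intro pos_eqI) auto
      then show ?thesis using \<open>v' = u\<close> by simp
    qed
  qed
qed

text \<open>A vertex is an end of its apex edge, so lying on another edge would make these two edges
  cross there. For the apex itself, its edge to \<open>v\<close> serves.\<close>

lemma pos_on_segment:
  assumes "pos H w \<in> closed_segment (pos H u) (pos H v)" "fan_edge H u v"
  shows "w \<in> {u, v}"
proof (cases "w = 0")
  case True
  show ?thesis
  proof (rule ccontr)
    assume w: "w \<notin> {u, v}"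
    then have "fan_edge H 0 v" "(0, v) \<noteq> (u, v)" using True by (auto simp: fan_edge_def)
    then have "pos H w \<in> pos H ` ({0, v} \<inter> {u, v})"
      using assms True by (intro fan_crossing) auto
    then show False using w True by (auto dest: injD[OF inj_pos])
  qed
next
  case False
  then have e: "fan_edge H 0 w" by (simp add: fan_edge_def)
  show ?thesis
  proof (cases "(0, w) = (u, v)")
    case False
    then have "pos H w \<in> pos H ` ({0, w} \<inter> {u, v})"
      using assms e by (intro fan_crossing) auto
    then show ?thesis using \<open>w \<noteq> 0\<close> by (auto dest: injD[OF inj_pos])
  qed simp
qed

section \<open>The straight-line drawing\<close>

lemma planar_fan: "planar (graph_on (fan_rel H) V)"
proof -
  \<comment> \<open>Edges are given as unordered pairs; \<open>Min\<close> and \<open>Max\<close>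
    recover the order of the arguments of \<open>fan_edge\<close>.\<close>
  define \<gamma> where "\<gamma> e = linepath (pos H (Min e)) (pos H (Max e))" for e
  have sorted: "\<exists>x y. {u, v} = {x, y} \<and> fan_edge H x y \<and> \<gamma> {u, v} = linepath (pos H x) (pos H y)"
    if "(u, v) \<in> parcs (graph_on (fan_rel H) V)" for u v
  proof -
    have *: "\<gamma> {x, y} = linepath (pos H x) (pos H y)" if "fan_edge H x y" for x y
      using that unfolding \<gamma>_def fan_edge_def by (simp add: max_def min_def)
    have "fan_edge H u v \<or> fan_edge H v u" using that by (simp add: graph_on_def fan_rel_def)
    then show ?thesis
    proof
      assume "fan_edge H v u"
      then show ?thesis using *[of v u] by (intro exI[of _ v] exI[of _ u]) (simp add: insert_commute)
    qed (use * in blast)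
  qed
  let ?A = "parcs (graph_on (fan_rel H) V)"
  have V: "u \<in> V \<and> v \<in> V" if "(u, v) \<in> ?A" for u v
    using that by (simp add: graph_on_def)
  have arc: "Path_Connected.arc (\<gamma> {u, v}) \<and>
      {pathstart (\<gamma> {u, v}), pathfinish (\<gamma> {u, v})} = {pos H u, pos H v} \<and>
      path_image (\<gamma> {u, v}) \<inter> pos H ` V = {pos H u, pos H v}" if uv: "(u, v) \<in> ?A" for u v
  proof -
    obtain x y where xy: "{u, v} = {x, y}" "fan_edge H x y"
      and g: "\<gamma> {u, v} = linepath (pos H x) (pos H y)" using sorted[OF uv] by blast
    have "x \<noteq> y" using xy(2) by (simp add: fan_edge_def)
    have eq: "{pos H u, pos H v} = {pos H x, pos H y}"
      using arg_cong[OF xy(1), of "image (pos H)"] by simp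
    have "x \<in> V" "y \<in> V" using V[OF uv] xy(1) by (auto simp: doubleton_eq_iff)
    then have "closed_segment (pos H x) (pos H y) \<inter> pos H ` V = {pos H x, pos H y}"
      using pos_on_segment[OF _ xy(2)] by auto
    then show ?thesis
      unfolding g eq using \<open>x \<noteq> y\<close> inj_pos[of H] by (auto simp: inj_eq)
  qed
  have cross: "path_image (\<gamma> {u, v}) \<inter> path_image (\<gamma> {u', v'}) \<subseteq> pos H ` ({u, v} \<inter> {u', v'})"
    if uv: "(u, v) \<in> ?A" and uv': "(u', v') \<in> ?A" and ne: "{u, v} \<noteq> {u', v'}" for u v u' v'
  proof
    obtain x y where xy: "{u, v} = {x, y}" "fan_edge H x y"
      and g: "\<gamma> {u, v} = linepath (pos H x) (pos H y)" using sorted[OF uv] by blast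
    obtain x' y' where xy': "{u', v'} = {x', y'}" "fan_edge H x' y'"
      and g': "\<gamma> {u', v'} = linepath (pos H x') (pos H y')" using sorted[OF uv'] by blast
    fix z assume "z \<in> path_image (\<gamma> {u, v}) \<inter> path_image (\<gamma> {u', v'})"
    then have "z \<in> closed_segment (pos H x) (pos H y)" "z \<in> closed_segment (pos H x') (pos H y')"
      unfolding g g' by simp_all
    moreover have "(x, y) \<noteq> (x', y')" using ne xy(1) xy'(1) by blast
    ultimately show "z \<in> pos H ` ({u, v} \<inter> {u', v'})"
      using fan_crossing[OF _ _ xy(2) xy'(2)] unfolding xy(1) xy'(1) by simp
  qed
  have "inj_on (pos H) V" using inj_pos inj_on_subset by blast
  then have "plane_drawing (graph_on (fan_rel H) V) (pos H) \<gamma>"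
    unfolding plane_drawing_def pverts_graph_on
    by (intro conjI ballI case_prodI2 impI; hypsubst?) (assumption | simp only: arc | rule cross)+
  then show ?thesis unfolding planar_def by blast
qed

lemma pair_graph_fan:
  assumes "finite V"
  shows "pair_graph (graph_on (fan_rel H) V)"
proof -
  have "finite (Restr (fan_rel H) V)" using assms by simp
  then show ?thesis
    using assms
    by unfold_locales
      (auto simp: graph_on_def fan_rel_def fan_edge_def symmetric_def arcs_ends_conv intro!: symI)
qed

lemma sym_fan_rel: "sym (fan_rel H)"
  by (auto simp: fan_rel_def intro: symI)

section \<open>A planar graph with hat guessing number at least 22\<close>

text \<open>
  The lengths come from \<open>m (i + 1) = 22 - \<lfloor>22 * 6 / m i\<rfloor>\<close>; with 23 colours the
  same recursion gets stuck at 14.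
\<close>
lemma winning_path_22:
  assumes "sym E" and "\<And>i. Suc i < 10 \<Longrightarrow> (a + i, a + Suc i) \<in> E"
  shows "winning (graph_on E {a..<a + 10}) (\<lambda>_. 22) (\<lambda>_. 6)"
proof -
  define m :: "nat \<Rightarrow> nat" where "m i = [22, 16, 14, 13, 12, 11, 10, 9, 8, 6, 0] ! i" for i
  have all: "P 0 \<and> P 1 \<and> P 2 \<and> P 3 \<and> P 4 \<and> P 5 \<and> P 6 \<and> P 7 \<and> P 8 \<and> P 9 \<Longrightarrow> i < 10 \<Longrightarrow> P i"
    for P and i :: nat
  proof -
    assume "P 0 \<and> P 1 \<and> P 2 \<and> P 3 \<and> P 4 \<and> P 5 \<and> P 6 \<and> P 7 \<and> P 8 \<and> P 9" "i < 10"
    moreover from this have "i \<in> {0, 1, 2, 3, 4, 5, 6, 7, 8, 9}" by auto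
    ultimately show "P i" by auto
  qed
  have "m i \<le> 22" if "i < 10" for i using that by (rule all[rotated]) (simp add: m_def)
  moreover have "m 10 = 0" by (simp add: m_def)
  ultimately have "m i \<le> 22" if "i \<le> 10" for i
    using that by (metis le_neq_implies_less zero_le)
  moreover have "(22 - m (Suc i)) * m i \<le> 22 * 6" if "i < 10" for i
    using that by (rule all[rotated]) (simp add: m_def)
  ultimately show ?thesis
    using assms by (intro winning_path[where m = m]) (auto simp: m_def)
qed

theorem theorem3p11:
  shows "HG_class 1 Planar \<ge> 22"
proof -
  \<comment> \<open>\<open>subs s\<close> indexes the copies below an apex with \<open>s\<close>
    guesses; the bijection \<open>f s\<close> numbers them so that they can be laid out
    consecutively.\<close>
  define subs where "subs s = {T :: nat set. T \<subseteq> {..<22} \<and> card T = Suc s}" for s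
  have "\<exists>f. bij_betw f (subs s) {0..<card (subs s)}" for s
    by (rule ex_bij_betw_finite_nat) (simp add: subs_def)
  then obtain f where f: "\<And>s. bij_betw (f s) (subs s) {0..<card (subs s)}" by metis
  have f_less: "f s T < card (subs s)" if "T \<in> subs s" for s T
    using bij_betwE[OF f] that by auto
  have f_inj: "f s T \<noteq> f s T'" if "T \<in> subs s" "T' \<in> subs s" "T \<noteq> T'" for s T T'
    using bij_betw_imp_inj_on[OF f[of s]] that by (auto dest: inj_onD)
  \<comment> \<open>A block is a hub followed by ten path vertices for each set of three colours.
    Hubs start at 1, which keeps 0 free for the apex.\<close>
  define M where "M = Suc (10 * card (subs 2))"
  define h where "h i = Suc (M * i)" for i
  define W where "W i = {h i..<h i + M}" for i
  define H where "H = range h"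
  define V where "V = insert 0 (\<Union>i<card (subs 1). W i)"
  \<comment> \<open>Successive paths in a block are also joined end to end by
    \<open>fan_rel\<close>; this is harmless, since a path sage uses only hats in its own path, its
    hub and the apex.\<close>
  let ?E = "fan_rel H" and ?P = "\<lambda>i T. {Suc (h i) + 10 * f 2 T..<Suc (h i) + 10 * f 2 T + 10}"
  have between: "l * m \<le> v \<Longrightarrow> v < l * m + l \<Longrightarrow> l * m' \<le> v \<Longrightarrow> v < l * m' + l \<Longrightarrow> m = m'"
    for l m m' v :: nat
    by (metis add.commute div_nat_eqI mult_Suc_right)
  have no_hub: "v \<notin> H" if "h i < v" "v < h i + M" for i v
  proof
    assume "v \<in> H"
    then obtain j where "v = h j" unfolding H_def by blast
    then show False using that between[of M i "v - 1" j] unfolding h_def M_def by force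
  qed
  have disj: "l * m + l \<le> l * m' \<or> l * m' + l \<le> l * m" if "m \<noteq> m'" for l m m' :: nat
    using that by (metis linorder_neqE_nat Suc_leI mult_Suc_right mult_le_mono2 add.commute)
  have P_W: "?P i T \<subseteq> W i - {h i}" if "T \<in> subs 2" for i T
    using f_less[OF that] unfolding W_def M_def by auto
  have path: "winning (graph_on ?E (?P i T)) (\<lambda>_. 22) (\<lambda>_. 6)" if T: "T \<in> subs 2" for i T
  proof (rule winning_path_22[OF sym_fan_rel])
    fix j :: nat assume "Suc j < 10"
    then have "Suc (h i) + 10 * f 2 T + Suc j \<in> ?P i T" by simp
    then have "Suc (h i) + 10 * f 2 T + Suc j \<in> W i - {h i}" using P_W[OF T] by blast
    then show "(Suc (h i) + 10 * f 2 T + j, Suc (h i) + 10 * f 2 T + Suc j) \<in> ?E"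
      using no_hub[of i] unfolding fan_rel_def fan_edge_def W_def by auto
  qed
  have hub: "(h i, v) \<in> ?E" if "v \<in> W i - {h i}" for i v
  proof -
    have "h i \<in> H" by (simp add: H_def)
    moreover have "h i < v" "{h i<..v} \<inter> H = {}" using that no_hub[of i] by (auto simp: W_def)
    ultimately show ?thesis unfolding fan_rel_def fan_edge_def by simp
  qed
  \<comment> \<open>The hub has 2 guesses, so each path may use \<open>2 * 3 = 6\<close>.\<close>
  have block: "winning (graph_on ?E (W i)) (\<lambda>_. 22) (\<lambda>_. 2)" for i
  proof (rule winning_cone[where a = "h i" and W = "?P i"])
    show "h i \<in> W i" unfolding W_def M_def by simp
    show "?P i T \<subseteq> W i \<inter> ?E `` {h i} - {h i}" if "T \<subseteq> {..<22}" "card T = Suc 2" for T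
      using P_W[of T i] hub[of _ i] that unfolding subs_def by auto
    show "?P i T \<inter> ?P i T' = {}" if "T \<subseteq> {..<22}" "card T = Suc 2" "T' \<subseteq> {..<22}" "card T' = Suc 2" "T \<noteq> T'"
      for T T'
      using disj[OF f_inj[of T 2 T'], of 10] that unfolding subs_def by auto
    show "winning (graph_on ?E (?P i T)) (\<lambda>_. 22) (\<lambda>_. 2 * Suc 2)"
      if "T \<subseteq> {..<22}" "card T = Suc 2" for T
      using path[of T i] that unfolding subs_def by simp
  qed (simp_all add: sym_fan_rel)
  \<comment> \<open>The apex has 1 guess, so each block may use \<open>1 * 2 = 2\<close>; there is
    one block for each pair of colours.\<close>
  have "winning (graph_on ?E V) (\<lambda>_. 22) (\<lambda>_. 1)"
  proof (rule winning_cone[where a = 0 and W = "\<lambda>T. W (f 1 T)"])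
    show "W (f 1 T) \<subseteq> V \<inter> ?E `` {0} - {0}" if "T \<subseteq> {..<22}" "card T = Suc 1" for T
      using f_less[of T 1] that
      unfolding subs_def V_def W_def fan_rel_def fan_edge_def h_def by auto
    show "W (f 1 T) \<inter> W (f 1 T') = {}"
      if "T \<subseteq> {..<22}" "card T = Suc 1" "T' \<subseteq> {..<22}" "card T' = Suc 1" "T \<noteq> T'" for T T'
      using disj[OF f_inj[of T 1 T'], of M] that unfolding subs_def W_def h_def by auto
    show "winning (graph_on ?E (W (f 1 T))) (\<lambda>_. 22) (\<lambda>_. 1 * Suc 1)" for T
      using block by (simp add: numeral_2_eq_2)
  qed (simp_all add: sym_fan_rel V_def)
  then have "enat 22 \<le> HG 1 (graph_on ?E V)"
    unfolding HG_def by (intro Sup_upper) blast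
  moreover have "graph_on ?E V \<in> Planar"
    unfolding Planar_def using pair_graph_fan planar_fan by (auto simp: V_def W_def)
  ultimately show ?thesis
    unfolding HG_class_def by (metis SUP_upper2 numeral_eq_enat)
qed

end
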